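(* Let $\|\cdot\|$ be a norm on $\mathbb{R}^d$ with dual norm $\|\cdot\|_*$, and let $\mathcal{C}\subset\mathbb{R}^d$ be a nonempty compact set that is $(\alpha,q)$-uniformly convex with respect to $\|\cdot\|$, with $\alpha>0$, $q\ge2$. Let $(c_t)_{t\ge1}$ be vectors in a bounded set $\mathcal{W}\subset\mathbb{R}^d$, let $M=\sup_{c\in\mathcal{W}}\|c\|_*$, and consider the linear losses $l_t(x)=\langle c_t;x\rangle$. Let $T\ge1$ and assume $L_T=\min_{1\le t\le T}\big\|\frac1t\sum_{\tau=1}^tc_\tau\big\|_*>0$. Then the regret $R_T$ of Follow-The-Leader satisfies $$R_T\le 2M\Big(\frac{2M}{\alpha L_T}\Big)^{1/(q-1)}\Big(\frac{q-1}{q-2}\Big)T^{1-1/(q-1)}\quad\text{when }q>2,$$ $$R_T\le\frac{4M^2}{\alpha L_T}\,(1+\log T)\quad\text{when }q=2.$$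
   Context: Dual norm: $\|d\|_*=\max_{\|x\|\le1}\langle x;d\rangle$. Uniform convexity of a set: a closed set $\mathcal{C}\subset\mathbb{R}^d$ is $(\alpha,q)$-uniformly convex with respect to $\|\cdot\|$ if for all $x,y\in\mathcal{C}$, all $\eta\in[0,1]$ and all $z\in\mathbb{R}^d$ with $\|z\|=1$, $\eta x+(1-\eta)y+\eta(1-\eta)\alpha\|x-y\|^q z\in\mathcal{C}$. Follow-The-Leader (FTL): at each time $t\ge1$ the action is any $x_t\in\arg\min_{x\in\mathcal{C}}\big\langle\sum_{\tau=1}^{t-1}c_\tau;x\big\rangle$ (so $x_1\in\mathcal{C}$ is arbitrary). The regret is $R_T=\sum_{t=1}^Tl_t(x_t)-\min_{x\in\mathcal{C}}\sum_{t=1}^Tl_t(x)$. *)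

theory Defs
  imports "HOL-Analysis.Analysis"
begin

text \<open>An arbitrary norm on a real vector space, as opposed to the type-class norm, which on
  \<open>real ^ 'd\<close> is the Euclidean one.\<close>

definition is_norm :: "('a::real_vector \<Rightarrow> real) \<Rightarrow> bool" where
  "is_norm N \<longleftrightarrow>
     (\<forall>x. 0 \<le> N x) \<and>
     (\<forall>x. N x = 0 \<longleftrightarrow> x = 0) \<and>
     (\<forall>a x. N (a *\<^sub>R x) = \<bar>a\<bar> * N x) \<and>
     (\<forall>x y. N (x + y) \<le> N x + N y)"

text \<open>In finite dimension the unit ball of a norm is compact, so the supremum is a maximum.\<close>

definition dual_norm :: "('a::real_inner \<Rightarrow> real) \<Rightarrow> 'a \<Rightarrow> real" where
  "dual_norm N d = (SUP x\<in>{x. N x \<le> 1}. x \<bullet> d)"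

definition uniformly_convex_set ::
    "('a::real_normed_vector \<Rightarrow> real) \<Rightarrow> real \<Rightarrow> real \<Rightarrow> 'a set \<Rightarrow> bool" where
  "uniformly_convex_set N \<alpha> q C \<longleftrightarrow>
     closed C \<and>
     (\<forall>x\<in>C. \<forall>y\<in>C. \<forall>\<eta>\<in>{0..1}. \<forall>z. N z = 1 \<longrightarrow>
        \<eta> *\<^sub>R x + (1 - \<eta>) *\<^sub>R y + (\<eta> * (1 - \<eta>) * \<alpha> * N (x - y) powr q) *\<^sub>R z \<in> C)"

text \<open>Time starts at 1; the values of \<open>c\<close> and \<open>x\<close> at index 0 play no role. For \<open>t = 1\<close> the sum
  is empty, so \<open>x 1\<close> is only required to lie in \<open>C\<close>.\<close>

definition follow_the_leader ::
    "'a::real_inner set \<Rightarrow> (nat \<Rightarrow> 'a) \<Rightarrow> (nat \<Rightarrow> 'a) \<Rightarrow> bool" where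
  "follow_the_leader C c x \<longleftrightarrow>
     (\<forall>t\<ge>1. is_arg_min (\<lambda>u. (\<Sum>\<tau>=1..<t. c \<tau>) \<bullet> u) (\<lambda>u. u \<in> C) (x t))"

text \<open>For continuous losses and nonempty compact \<open>C\<close> the infimum is a minimum.\<close>

definition regret :: "'a set \<Rightarrow> (nat \<Rightarrow> 'a \<Rightarrow> real) \<Rightarrow> (nat \<Rightarrow> 'a) \<Rightarrow> nat \<Rightarrow> real" where
  "regret C l x T = (\<Sum>t=1..T. l t (x t)) - (INF u\<in>C. \<Sum>t=1..T. l t u)"

end

theory Submission
  imports Defs
begin

text \<open>Put \<open>s t = (\<Sum>\<tau>=1..t. c \<tau>)\<close>, so that \<open>x (t+1)\<close> minimises \<open>s t\<close>. By induction (``be the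
  leader'') the regret is at most \<open>\<Sum>t. c t \<bullet> (x t - x (t+1))\<close>. Uniform convexity improves the
  first-order optimality of a minimiser \<open>v\<close> of a linear form \<open>d\<close> to
  \<open>\<alpha> * N (y - v) powr q * dual_norm N d \<le> d \<bullet> (y - v)\<close>. For \<open>d = s t / t\<close>, \<open>v = x (t+1)\<close>,
  \<open>y = x t\<close>, and because \<open>x t\<close> minimises \<open>s (t-1)\<close>, this gives
  \<open>\<alpha> * t * L * N (x t - x (t+1)) powr q \<le> c t \<bullet> (x t - x (t+1)) \<le> M * N (x t - x (t+1))\<close>. Hence the
  \<open>t\<close>-th term is at most \<open>M * (M / (\<alpha> * t * L)) powr (1 / (q - 1))\<close>.\<close>

section \<open>Norms in finite dimension and their dual norms\<close>

text \<open>A convex function on a finite-dimensional space is continuous, so \<open>N\<close>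
  attains a minimum on the Euclidean unit sphere. It is positive by definiteness, and homogeneity
  carries the bound to all vectors.\<close>

lemma is_norm_lower_bound:
  fixes N :: "'a::euclidean_space \<Rightarrow> real"
  assumes "is_norm N"
  obtains m where "m > 0" and "\<And>x. m * norm x \<le> N x"
proof -
  have scale: "N (a *\<^sub>R x) = \<bar>a\<bar> * N x" and triangle: "N (x + y) \<le> N x + N y"
    and nonneg: "0 \<le> N x" and zero: "N x = 0 \<longleftrightarrow> x = 0" for a x y
    using assms unfolding is_norm_def by blast+
  have "convex_on UNIV N"
  proof (intro convex_onI)
    fix t :: real and x y :: 'a
    assume "0 < t" "t < 1"
    then show "N ((1 - t) *\<^sub>R x + t *\<^sub>R y) \<le> (1 - t) * N x + t * N y"
      using triangle[of "(1 - t) *\<^sub>R x" "t *\<^sub>R y"] by (simp add: scale)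
  qed simp
  then have "continuous_on UNIV N"
    by (intro convex_on_continuous) auto
  then have cont: "continuous_on (sphere 0 1) N"
    using continuous_on_subset by blast
  have "sphere (0::'a) 1 \<noteq> {}"
    by simp
  then obtain w where w: "w \<in> sphere 0 1" and least: "\<And>y. y \<in> sphere 0 1 \<Longrightarrow> N w \<le> N y"
    using continuous_attains_inf[OF compact_sphere _ cont] by blast
  have "N w * norm x \<le> N x" for x
  proof (cases "x = 0")
    case True
    then show ?thesis using nonneg[of x] by simp
  next
    case False
    have "N w \<le> N ((1 / norm x) *\<^sub>R x)"
      using False by (intro least) simp
    then show ?thesis
      using False by (simp add: scale field_simps)
  qed
  moreover have "N w > 0"
    using w nonneg[of w] zero[of w] by fastforce
  ultimately show thesis using that by blast
qed

text \<open>This makes the supremum in \<open>dual_norm\<close> range over a bounded set, without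
  which \<open>SUP\<close> on the reals says nothing. The unit ball of \<open>N\<close> lies in a
  Euclidean ball of radius \<open>1 / m\<close>, and Cauchy-Schwarz does the rest.\<close>

lemma inner_le_dual_norm_bound:
  fixes N :: "'a::euclidean_space \<Rightarrow> real"
  assumes "is_norm N"
  obtains K where "K > 0" and "\<And>x d. N x \<le> 1 \<Longrightarrow> x \<bullet> d \<le> K * norm d"
proof -
  obtain m where m: "m > 0" "\<And>x. m * norm x \<le> N x"
    using is_norm_lower_bound[OF assms] by blast
  have "x \<bullet> d \<le> (1 / m) * norm d" if "N x \<le> 1" for x d
  proof -
    have "m * norm x \<le> 1"
      using m(2)[of x] that by simp
    then have "norm x \<le> 1 / m"
      using m(1) by (simp add: field_simps)
    then have "norm x * norm d \<le> (1 / m) * norm d"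
      by (intro mult_right_mono) auto
    then show ?thesis
      using norm_cauchy_schwarz[of x d] by linarith
  qed
  then show thesis
    using that[of "1 / m"] m(1) by simp
qed

lemma dual_norm_upper:
  fixes N :: "'a::euclidean_space \<Rightarrow> real"
  assumes "is_norm N" "N x \<le> 1"
  shows "x \<bullet> d \<le> dual_norm N d"
proof -
  obtain K where "\<And>x d. N x \<le> 1 \<Longrightarrow> x \<bullet> d \<le> K * norm d"
    using inner_le_dual_norm_bound[OF assms(1)] by blast
  then have "bdd_above ((\<lambda>x. x \<bullet> d) ` {x. N x \<le> 1})"
    by (intro bdd_aboveI[of _ "K * norm d"]) auto
  then show ?thesis
    unfolding dual_norm_def using assms(2) by (intro cSUP_upper) auto
qed

lemma dual_norm_least:
  fixes N :: "'a::euclidean_space \<Rightarrow> real"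
  assumes "is_norm N" "\<And>x. N x \<le> 1 \<Longrightarrow> x \<bullet> d \<le> B"
  shows "dual_norm N d \<le> B"
proof -
  have "N 0 = 0"
    using assms(1) unfolding is_norm_def by blast
  then have "0 \<in> {x. N x \<le> 1}"
    by simp
  then show ?thesis
    unfolding dual_norm_def using assms(2) by (intro cSUP_least) auto
qed

lemma dual_norm_nonneg:
  fixes N :: "'a::euclidean_space \<Rightarrow> real"
  assumes "is_norm N"
  shows "0 \<le> dual_norm N d"
proof -
  have "N 0 = 0"
    using assms unfolding is_norm_def by blast
  then show ?thesis
    using dual_norm_upper[OF assms, of 0 d] by simp
qed

lemma inner_le_dual_norm:
  fixes N :: "'a::euclidean_space \<Rightarrow> real"
  assumes "is_norm N"
  shows "d \<bullet> x \<le> dual_norm N d * N x"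
proof (cases "x = 0")
  case True
  then have "N x = 0"
    using assms unfolding is_norm_def by blast
  with True show ?thesis by simp
next
  case False
  then have pos: "N x > 0"
    using assms unfolding is_norm_def by (metis less_eq_real_def)
  have "N ((1 / N x) *\<^sub>R x) = \<bar>1 / N x\<bar> * N x"
    using assms unfolding is_norm_def by blast
  then have "N ((1 / N x) *\<^sub>R x) \<le> 1"
    using pos by simp
  from dual_norm_upper[OF assms this, of d] show ?thesis
    using pos by (simp add: field_simps inner_commute)
qed

lemma bdd_above_dual_norm:
  fixes N :: "'a::euclidean_space \<Rightarrow> real"
  assumes "is_norm N" "bounded W"
  shows "bdd_above (dual_norm N ` W)"
proof -
  obtain K where K: "K > 0" "\<And>x d. N x \<le> 1 \<Longrightarrow> x \<bullet> d \<le> K * norm d"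
    using inner_le_dual_norm_bound[OF assms(1)] by blast
  obtain B where B: "\<And>w. w \<in> W \<Longrightarrow> norm w \<le> B"
    using assms(2) unfolding bounded_iff by blast
  have "dual_norm N w \<le> K * B" if "w \<in> W" for w
  proof -
    have "dual_norm N w \<le> K * norm w"
      using K(2) by (intro dual_norm_least[OF assms(1)])
    also have "\<dots> \<le> K * B"
      using K(1) B[OF that] by simp
    finally show ?thesis .
  qed
  then show ?thesis
    by (intro bdd_aboveI2)
qed

section \<open>Linear forms on a uniformly convex set\<close>

text \<open>Moving from \<open>v\<close> a small fraction towards \<open>y\<close> leaves room in
  \<open>C\<close> for a further shift along any direction. Minimality of \<open>v\<close> at the
  shifted point bounds the gain of that shift; the best direction produces the dual norm.\<close>

lemma uniformly_convex_set_minimizer: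
  fixes N :: "'a::euclidean_space \<Rightarrow> real"
  assumes norm: "is_norm N" and conv: "uniformly_convex_set N \<alpha> q C" and "\<alpha> > 0"
    and v: "v \<in> C" and min: "\<And>u. u \<in> C \<Longrightarrow> d \<bullet> v \<le> d \<bullet> u" and y: "y \<in> C"
  shows "\<alpha> * N (y - v) powr q * dual_norm N d \<le> d \<bullet> (y - v)"
proof -
  define D where "D = \<alpha> * N (y - v) powr q"
  have D: "D \<ge> 0"
    using \<open>\<alpha> > 0\<close> by (simp add: D_def)
  have opt: "0 \<le> d \<bullet> (y - v)"
    using min[OF y] by (simp add: inner_diff_right)
  \<comment> \<open>The test point has weight \<open>1 - r\<close> on \<open>y\<close> and is
    shifted along \<open>- z\<close>. After division by \<open>1 - r\<close> a factor
    \<open>r < 1\<close> remains on the left; having the bound for all such \<open>r\<close>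
    replaces the limit \<open>r\<close> to 1.\<close>
  have sphere: "D * (z \<bullet> d) \<le> d \<bullet> (y - v)" if z: "N z = 1" for z
  proof (rule field_le_mult_one_interval)
    fix r :: real
    assume r: "0 < r" "r < 1"
    have "N ((-1) *\<^sub>R z) = \<bar>-1\<bar> * N z"
      using norm unfolding is_norm_def by blast
    then have "N (- z) = 1"
      using z by simp
    moreover have "1 - r \<in> {0..1}"
      using r by simp
    ultimately have "(1 - r) *\<^sub>R y + (1 - (1 - r)) *\<^sub>R v
        + ((1 - r) * (1 - (1 - r)) * \<alpha> * N (y - v) powr q) *\<^sub>R (- z) \<in> C"
      using conv y v unfolding uniformly_convex_set_def by blast
    from min[OF this] have "0 \<le> (1 - r) * (d \<bullet> (y - v) - r * (D * (z \<bullet> d)))"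
      by (simp add: D_def inner_add_right inner_diff_right inner_commute algebra_simps)
    then show "r * (D * (z \<bullet> d)) \<le> d \<bullet> (y - v)"
      using r by (simp add: zero_le_mult_iff)
  qed
  \<comment> \<open>\<open>dual_norm\<close> is a supremum over the ball, not the sphere. If
    \<open>w \<bullet> d\<close> is positive, \<open>w\<close> is normalised; otherwise the left
    side is at most 0.\<close>
  have ball: "D * (w \<bullet> d) \<le> d \<bullet> (y - v)" if w: "N w \<le> 1" for w
  proof (cases "w \<bullet> d \<le> 0")
    case True
    then have "D * (w \<bullet> d) \<le> 0"
      using D by (simp add: mult_nonneg_nonpos)
    then show ?thesis using opt by linarith
  next
    case False
    then have "w \<noteq> 0" by auto
    then have pos: "N w > 0"
      using norm unfolding is_norm_def by (metis less_eq_real_def)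
    have "N ((1 / N w) *\<^sub>R w) = \<bar>1 / N w\<bar> * N w"
      using norm unfolding is_norm_def by blast
    then have "N ((1 / N w) *\<^sub>R w) = 1"
      using pos by simp
    from sphere[OF this] have "D * (w \<bullet> d) \<le> d \<bullet> (y - v) * N w"
      using pos by (simp add: field_simps)
    also have "\<dots> \<le> d \<bullet> (y - v)"
      using opt w by (simp add: mult_left_le)
    finally show ?thesis .
  qed
  show ?thesis
  proof (cases "D = 0")
    case True
    then show ?thesis using opt by (simp flip: D_def)
  next
    case False
    then have "D > 0" using D by simp
    then have "dual_norm N d \<le> d \<bullet> (y - v) / D"
      using ball by (intro dual_norm_least[OF norm]) (simp add: field_simps)
    then show ?thesis
      using \<open>D > 0\<close> by (simp add: D_def field_simps)
  qed
qed

section \<open>Regret through the one-step lookahead\<close>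

lemma follow_the_leader_mem:
  assumes "follow_the_leader C c x" "t \<ge> 1"
  shows "x t \<in> C"
  using assms unfolding follow_the_leader_def is_arg_min_def by blast

lemma follow_the_leader_min:
  assumes "follow_the_leader C c x" "u \<in> C"
  shows "(\<Sum>\<tau>=1..t. c \<tau>) \<bullet> x (Suc t) \<le> (\<Sum>\<tau>=1..t. c \<tau>) \<bullet> u"
proof -
  have "is_arg_min (\<lambda>u. (\<Sum>\<tau>=1..<Suc t. c \<tau>) \<bullet> u) (\<lambda>u. u \<in> C) (x (Suc t))"
    using assms(1)[unfolded follow_the_leader_def, rule_format, of "Suc t"] by simp
  then show ?thesis
    using assms(2) unfolding is_arg_min_def atLeastLessThanSuc_atLeastAtMost
    by (meson not_le)
qed

text \<open>In the induction step the leader \<open>x (Suc T)\<close> is compared with its successor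
  \<open>x (Suc (Suc T))\<close> on the first \<open>T\<close> costs; adding the cost of the new
  round to both sides closes it.\<close>

lemma be_the_leader:
  assumes "follow_the_leader C c x"
  shows "(\<Sum>t=1..T. c t \<bullet> x (Suc t)) \<le> (\<Sum>t=1..T. c t) \<bullet> x (Suc T)"
proof (induction T)
  case 0
  show ?case by simp
next
  case (Suc T)
  have "(\<Sum>t=1..T. c t) \<bullet> x (Suc T) \<le> (\<Sum>t=1..T. c t) \<bullet> x (Suc (Suc T))"
    by (intro follow_the_leader_min[OF assms] follow_the_leader_mem[OF assms]) simp
  with Suc.IH show ?case
    by (simp add: inner_add_left)
qed

lemma regret_follow_the_leader_le:
  assumes ftl: "follow_the_leader C c x" and lin: "\<And>t u. t \<ge> 1 \<Longrightarrow> l t u = c t \<bullet> u"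
  shows "regret C l x T \<le> (\<Sum>t=1..T. c t \<bullet> (x t - x (Suc t)))"
proof -
  have cumulative: "(\<Sum>t=1..T. l t u) = (\<Sum>t=1..T. c t) \<bullet> u" for u
    by (simp add: lin inner_sum_left)
  have "C \<noteq> {}"
    using follow_the_leader_mem[OF ftl] by blast
  then have "(\<Sum>t=1..T. c t) \<bullet> x (Suc T) \<le> (INF u\<in>C. \<Sum>t=1..T. l t u)"
    unfolding cumulative using follow_the_leader_min[OF ftl] by (intro cINF_greatest)
  moreover have "(\<Sum>t=1..T. l t (x t)) = (\<Sum>t=1..T. c t \<bullet> x t)"
    by (simp add: lin)
  ultimately show ?thesis
    using be_the_leader[OF ftl, of T]
    by (simp add: regret_def inner_diff_right sum_subtractf)
qed

section \<open>Power and harmonic sums\<close>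

text \<open>A telescoping form of the integral comparison: each term is at most the increment of the
  right-hand side from \<open>n\<close> to \<open>Suc n\<close>.\<close>

lemma sum_powr_neg_le:
  fixes p :: real
  assumes "0 < p" "p < 1"
  shows "(\<Sum>t=1..n. real t powr (- p)) \<le> real n powr (1 - p) / (1 - p)"
proof (induction n)
  case 0
  show ?case by simp
next
  case (Suc n)
  define m where "m = real (Suc n)"
  have m: "m > 0" by (simp add: m_def)
  \<comment> \<open>Weighted AM-GM for \<open>n\<close> and \<open>n + 1\<close>; multiplying by
    \<open>m powr (- p)\<close> then gives the increment bound. Young's inequality wants positive
    arguments, so \<open>n = 0\<close> is separate.\<close>
  have "real n powr (1 - p) * m powr p \<le> (1 - p) * real n + p * m"
  proof (cases "n = 0")
    case False
    then show ?thesis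
      using assms m by (intro Youngs_inequality_0) auto
  qed (use assms m in simp)
  also have "\<dots> = m - (1 - p)"
    by (simp add: m_def algebra_simps)
  finally have "real n powr (1 - p) * m powr p * m powr (- p) \<le> (m - (1 - p)) * m powr (- p)"
    by (intro mult_right_mono) auto
  moreover have "m powr p * m powr (- p) = 1"
    using m by (simp flip: powr_add)
  moreover have "m * m powr (- p) = m powr (1 - p)"
    using m powr_add[of m 1 "- p"] by simp
  ultimately have "real n powr (1 - p) \<le> m powr (1 - p) - (1 - p) * m powr (- p)"
    by (simp add: mult.assoc left_diff_distrib)
  then have "real n powr (1 - p) / (1 - p) \<le> (m powr (1 - p) - (1 - p) * m powr (- p)) / (1 - p)"
    using assms by (intro divide_right_mono) auto
  then have "real n powr (1 - p) / (1 - p) + m powr (- p) \<le> m powr (1 - p) / (1 - p)"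
    using assms by (simp add: diff_divide_distrib)
  with Suc.IH show ?case
    by (simp add: m_def)
qed

lemma sum_inverse_le_one_plus_ln:
  assumes "n \<ge> 1"
  shows "(\<Sum>t=1..n. 1 / real t) \<le> 1 + ln (real n)"
  using assms
proof (induction n rule: dec_induct)
  case base
  show ?case by simp
next
  case (step n)
  \<comment> \<open>The bound \<open>ln u \<le> u - 1\<close> at this ratio makes the logarithm grow
    by at least \<open>1 / real (Suc n)\<close>.\<close>
  have "ln (real n / real (Suc n)) \<le> real n / real (Suc n) - 1"
    using step.hyps by (intro ln_le_minus_one) simp
  also have "\<dots> = - (1 / real (Suc n))"
    by (simp add: field_simps)
  finally have "ln (real n) + 1 / real (Suc n) \<le> ln (real (Suc n))"
    using step.hyps by (simp add: ln_div)
  with step.IH show ?case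
    by simp
qed

section \<open>The bound for one round and its summation\<close>

lemma follow_the_leader_step:
  fixes N :: "'a::euclidean_space \<Rightarrow> real"
  assumes norm: "is_norm N" and conv: "uniformly_convex_set N \<alpha> q C" and \<alpha>: "\<alpha> > 0"
    and q: "q > 1" and ftl: "follow_the_leader C c x" and t: "t \<ge> 1" and L: "L > 0"
    and lower: "L \<le> dual_norm N ((1 / real t) *\<^sub>R (\<Sum>\<tau>=1..t. c \<tau>))"
    and upper: "dual_norm N (c t) \<le> M"
  shows "c t \<bullet> (x t - x (Suc t)) \<le> M * (M / (\<alpha> * L)) powr (1 / (q - 1)) * real t powr (- (1 / (q - 1)))"
proof -
  define s where "s = (\<lambda>t. \<Sum>\<tau>=1..t. c \<tau>)"
  define u where "u = x t - x (Suc t)"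
  define n where "n = N u"
  have M: "M \<ge> 0"
    using dual_norm_nonneg[OF norm, of "c t"] upper by linarith
  have n: "n \<ge> 0"
    using norm unfolding is_norm_def n_def by blast
  have xt: "x t \<in> C" and xSt: "x (Suc t) \<in> C"
    using follow_the_leader_mem[OF ftl] t by auto
  \<comment> \<open>\<open>L\<close> bounds the averaged cost, which has the same minimisers as
    \<open>s t\<close>; undoing the average yields the factor \<open>real t\<close> that makes the
    steps shrink.\<close>
  have "\<alpha> * n powr q * L \<le> \<alpha> * n powr q * dual_norm N ((1 / real t) *\<^sub>R s t)"
    using \<alpha> lower by (intro mult_left_mono) (auto simp: s_def)
  also have "\<dots> \<le> ((1 / real t) *\<^sub>R s t) \<bullet> u"
    unfolding n_def u_def s_def
  proof (rule uniformly_convex_set_minimizer[OF norm conv \<alpha> xSt _ xt])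
    fix w assume "w \<in> C"
    from follow_the_leader_min[OF ftl this, of t]
    show "((1 / real t) *\<^sub>R (\<Sum>\<tau>=1..t. c \<tau>)) \<bullet> x (Suc t) \<le> ((1 / real t) *\<^sub>R (\<Sum>\<tau>=1..t. c \<tau>)) \<bullet> w"
      by (simp add: divide_right_mono)
  qed
  finally have gap: "\<alpha> * n powr q * L * real t \<le> s t \<bullet> u"
    using t by (simp add: field_simps)
  have split: "s t = s (t - 1) + c t"
    using t by (cases t) (auto simp: s_def)
  have "s (t - 1) \<bullet> u \<le> 0"
    using follow_the_leader_min[OF ftl xSt, of "t - 1"] t
    by (simp add: s_def u_def inner_diff_right)
  with gap have "\<alpha> * n powr q * L * real t \<le> c t \<bullet> u"
    by (simp add: split inner_add_left)
  moreover have cu: "c t \<bullet> u \<le> M * n"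
    using inner_le_dual_norm[OF norm, of "c t" u] mult_right_mono[OF upper n]
    by (simp add: n_def)
  ultimately have key: "\<alpha> * n powr q * L * real t \<le> M * n"
    by linarith
  \<comment> \<open>Cancelling one factor \<open>n\<close> in \<open>key\<close> leaves the power
    \<open>q - 1\<close>, whose root is taken.\<close>
  have "n \<le> (M / (\<alpha> * L * real t)) powr (1 / (q - 1))"
  proof (cases "n = 0")
    case True
    then show ?thesis by simp
  next
    case False
    then have "n > 0" using n by simp
    have "n powr q = n powr (q - 1) * n"
      using \<open>n > 0\<close> powr_add[of n "q - 1" 1] by simp
    then have "\<alpha> * n powr (q - 1) * L * real t \<le> M"
      using key \<open>n > 0\<close> by simp
    then have "n powr (q - 1) \<le> M / (\<alpha> * L * real t)"
      using \<alpha> L t by (simp add: field_simps)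
    then have "(n powr (q - 1)) powr (1 / (q - 1)) \<le> (M / (\<alpha> * L * real t)) powr (1 / (q - 1))"
      using q by (intro powr_mono2) auto
    then show ?thesis
      using q \<open>n > 0\<close> by (simp add: powr_powr)
  qed
  also have "M / (\<alpha> * L * real t) = M / (\<alpha> * L) / real t"
    by simp
  also have "\<dots> powr (1 / (q - 1)) = (M / (\<alpha> * L)) powr (1 / (q - 1)) * real t powr (- (1 / (q - 1)))"
    using M \<alpha> L by (subst powr_divide) (auto simp: powr_minus divide_inverse)
  finally have "M * n \<le> M * ((M / (\<alpha> * L)) powr (1 / (q - 1)) * real t powr (- (1 / (q - 1))))"
    using M by (intro mult_left_mono) auto
  with cu show ?thesis
    by (simp add: u_def mult.assoc)
qed

theorem theorem3p1:
  fixes N :: "real ^ 'd \<Rightarrow> real"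
    and C W :: "(real ^ 'd) set"
    and c x :: "nat \<Rightarrow> real ^ 'd"
    and l :: "nat \<Rightarrow> real ^ 'd \<Rightarrow> real"
    and \<alpha> q M L :: real
    and T :: nat
  assumes "is_norm N"
    and "C \<noteq> {}" and "compact C"
    and "uniformly_convex_set N \<alpha> q C" and "\<alpha> > 0" and "q \<ge> 2"
    and "bounded W" and "\<And>t. t \<ge> 1 \<Longrightarrow> c t \<in> W"
    and "M = (SUP w\<in>W. dual_norm N w)"
    and "\<And>t u. t \<ge> 1 \<Longrightarrow> l t u = c t \<bullet> u"
    and "T \<ge> 1"
    and "L = (MIN t\<in>{1..T}. dual_norm N ((1 / real t) *\<^sub>R (\<Sum>\<tau>=1..t. c \<tau>)))"
    and "L > 0"
    and "follow_the_leader C c x"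
  shows "(q > 2 \<longrightarrow>
            regret C l x T \<le> 2 * M * (2 * M / (\<alpha> * L)) powr (1 / (q - 1)) * ((q - 1) / (q - 2))
                              * real T powr (1 - 1 / (q - 1))) \<and>
         (q = 2 \<longrightarrow>
            regret C l x T \<le> 4 * M\<^sup>2 / (\<alpha> * L) * (1 + ln (real T)))"
proof -
  define p where "p = 1 / (q - 1)"
  define A where "A = M / (\<alpha> * L)"
  have bdd: "bdd_above (dual_norm N ` W)"
    using bdd_above_dual_norm[OF assms(1,7)] .
  have upper: "dual_norm N (c t) \<le> M" if "t \<ge> 1" for t
    unfolding assms(9) using assms(8)[OF that] bdd by (intro cSUP_upper)
  have M: "M \<ge> 0"
    using upper[of 1] dual_norm_nonneg[OF assms(1), of "c 1"] by simp
  have A: "A \<ge> 0"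
    using M assms(5,13) by (simp add: A_def)
  have "c t \<bullet> (x t - x (Suc t)) \<le> M * A powr p * real t powr (- p)" if "t \<in> {1..T}" for t
  proof -
    have "L \<le> dual_norm N ((1 / real t) *\<^sub>R (\<Sum>\<tau>=1..t. c \<tau>))"
      unfolding assms(12) using that by (intro Min_le) auto
    then show ?thesis
      unfolding p_def A_def using that assms(6) upper
      by (intro follow_the_leader_step[OF assms(1,4,5) _ assms(14) _ assms(13)]) auto
  qed
  then have "(\<Sum>t=1..T. c t \<bullet> (x t - x (Suc t))) \<le> (\<Sum>t=1..T. M * A powr p * real t powr (- p))"
    by (rule sum_mono)
  then have bound: "regret C l x T \<le> M * A powr p * (\<Sum>t=1..T. real t powr (- p))"
    using regret_follow_the_leader_le[OF assms(14,10), of T] by (simp add: sum_distrib_left)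
  show ?thesis
  proof (intro conjI impI)
    assume q: "q > 2"
    then have p: "0 < p" "p < 1"
      by (auto simp: p_def)
    have "2 * M / (\<alpha> * L) = 2 * A"
      by (simp add: A_def)
    \<comment> \<open>The summed bound has the constant \<open>M * A powr p\<close>; both factors 2
      only loosen it to the stated form.\<close>
    then have "M * A powr p \<le> 2 * M * (2 * M / (\<alpha> * L)) powr p"
      using M A p by (intro mult_mono powr_mono2) auto
    moreover have "(\<Sum>t=1..T. real t powr (- p)) \<le> real T powr (1 - p) / (1 - p)"
      using p by (rule sum_powr_neg_le)
    ultimately have "M * A powr p * (\<Sum>t=1..T. real t powr (- p))
        \<le> 2 * M * (2 * M / (\<alpha> * L)) powr p * (real T powr (1 - p) / (1 - p))"
      by (rule mult_mono) (use M in \<open>auto intro: sum_nonneg\<close>)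
    also have "real T powr (1 - p) / (1 - p) = (q - 1) / (q - 2) * real T powr (1 - p)"
      using q by (simp add: p_def field_simps)
    finally show "regret C l x T \<le> 2 * M * (2 * M / (\<alpha> * L)) powr (1 / (q - 1))
        * ((q - 1) / (q - 2)) * real T powr (1 - 1 / (q - 1))"
      using bound unfolding p_def mult.assoc by linarith
  next
    assume "q = 2"
    then have p: "p = 1"
      by (simp add: p_def)
    have "(\<Sum>t=1..T. real t powr (- p)) = (\<Sum>t=1..T. 1 / real t)"
      by (intro sum.cong) (auto simp: p powr_minus divide_inverse)
    then have "(\<Sum>t=1..T. real t powr (- p)) \<le> 1 + ln (real T)"
      using sum_inverse_le_one_plus_ln[OF assms(11)] by simp
    \<comment> \<open>For \<open>p = 1\<close> the left side is a quarter of the right.\<close>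
    moreover have "M * A powr p \<le> 4 * M\<^sup>2 / (\<alpha> * L)"
      using M A assms(5,13) by (simp add: p A_def power2_eq_square divide_right_mono)
    ultimately have "M * A powr p * (\<Sum>t=1..T. real t powr (- p)) \<le> 4 * M\<^sup>2 / (\<alpha> * L) * (1 + ln (real T))"
      using assms(5,13) by (intro mult_mono sum_nonneg) auto
    then show "regret C l x T \<le> 4 * M\<^sup>2 / (\<alpha> * L) * (1 + ln (real T))"
      using bound by linarith
  qed
qed

end
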